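(* Let $G=(V,E)$ be a regular binary tree of height $h\ge 1$ and let $k=2^{k'}$, where $1\le k'\le h$. Let $\mathscr{V}^*$ be the optimal $k$-balanced partition of $G$ computed by the partitioning algorithm described in the context. Then the optimal value $c(G,\mathscr{V}^* )$ of the $k$-balanced partitioning problem in $G$ fulfils $$c(G,\mathscr{V}^* )\ge \frac{10}{7}k-2\quad\text{if } k'\le h-1,$$ $$c(G,\mathscr{V}^* )=\frac43 k-\frac32+\frac16(-1)^{\log_2 k}\quad\text{if } k'=h,$$ $$c(G,\mathscr{V}^* )=\frac32 k-2\quad\text{if } k'\le \left\lfloor\frac h2\right\rfloor+1.$$
   Context: Regular binary tree of height $h$: a rooted tree in which every non-leaf vertex has exactly two children (left and right) and all leaves are at distance $h$ from the root; the level of a vertex is its distance from the root. It has $n=2^{h+1}-1$ vertices. The left (right) basic subtree of a regular binary tree is the subtree rooted at the left (right) child of its root. $k$-balanced partition of a graph $G=(V,E)$ with $|V|=n$, $k\ge2$: a partition $\mathscr{V}=\{V_1,\dots,V_k\}$ of $V$ into $k$ non-empty pairwise disjoint sets with $|V_i|\le\lceil n/k\rceil$ for all $i$. Its value is $c(G,\mathscr{V})=|\{(u,v)\in E: u\in V_i,\ v\in V_j,\ i\ne j\}|$ (number of cut edges). The $k$-balanced partitioning problem ($k$-BPP) asks for a $k$-balanced partition minimising $c(G,\cdot)$; such a partition is called optimal. For $G$ regular binary of height $h$ and $k=2^{k'}$, $1\le k'\le h$, one partition set (the small one) has $2^{h-k'+1}-1$ elements and all others (the big ones) have $n_b=2^{h-k'+1}$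 elements. Partitioning algorithm for $G$ regular binary of height $h$ and $k=2^{k'}$. Let $t=h-k'+2$ and $e=\lfloor\frac{h+1}{t}\rfloor-1$. Step 1: cut all edges $(u,v)$ with $\mathrm{level}(u)=h-it$ and $\mathrm{level}(v)=h-it+1$, for $1\le i\le e$. This separates $e$ horizontal bands consisting of regular binary trees of height $t-1$, and leaves a top part that is a regular binary tree of height $\widehat h$, $t-1\le\widehat h\le 2t-2$. Let $p$ be the number of regular binary trees of height $t-1$ in these bands. Step 2: in each of these $p$ trees cut the edge from its root to its right child. Each root together with its left basic subtree forms a big partition set. Let $q=\frac{2^{h-k'+1}-1}{2^{h-k'+1}}\,p$ (an integer). Split $p-q$ of the $p$ right basic subtrees (arbitrarily chosen) into isolated vertices, giving $q$ isolated vertices, and pair these one-to-one with the remaining $q$ right basic subtrees; each pair forms a big partition set. Step 3: in the top part cut all edges $(u,v)$ with $\mathrm{level}(u)=h-(e+1)t+1$ and $v$ the right child of $u$. Each such $u$ together with its left basic subtree (in the top part) forms a big partition set. The right basic subtrees of these vertices $u$ are paired one-to-one with the vertices of level less than $h-(e+1)t+1$, each pair forming a big partition set; exactly one right basic subtree remains unpaired and forms the small partition set. *)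

theory Defs
  imports Complex_Main "HOL-Library.Disjoint_Sets"
begin

text \<open>Each undirected edge is listed exactly once in \<open>edges\<close>, as an ordered pair; in a rooted
  tree the pairs point from the parent to the child. Thus the number of cut edges counts every
  undirected edge once.\<close>

record 'a graph =
  verts :: "'a set"
  edges :: "('a \<times> 'a) set"

record 'a binary_tree = "'a graph" +
  root :: 'a
  left :: "'a \<Rightarrow> 'a"
  right :: "'a \<Rightarrow> 'a"

definition balanced_partition :: "('a, 'b) graph_scheme \<Rightarrow> nat \<Rightarrow> 'a set set \<Rightarrow> bool" where
  "balanced_partition G k P \<longleftrightarrow>
     partition_on (verts G) P \<and> card P = k \<and>
     (\<forall>A\<in>P. int (card A) \<le> \<lceil>real (card (verts G)) / real k\<rceil>)"

definition cut_value :: "('a, 'b) graph_scheme \<Rightarrow> 'a set set \<Rightarrow> nat" where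
  "cut_value G P = card {(u, v). (u, v) \<in> edges G \<and> (\<exists>A\<in>P. \<exists>B\<in>P. A \<noteq> B \<and> u \<in> A \<and> v \<in> B)}"

definition optimal_partition :: "('a, 'b) graph_scheme \<Rightarrow> nat \<Rightarrow> 'a set set \<Rightarrow> bool" where
  "optimal_partition G k P \<longleftrightarrow>
     balanced_partition G k P \<and>
     (\<forall>Q. balanced_partition G k Q \<longrightarrow> cut_value G P \<le> cut_value G Q)"

definition rooted_tree :: "('a, 'b) binary_tree_scheme \<Rightarrow> bool" where
  "rooted_tree G \<longleftrightarrow>
     finite (verts G) \<and> edges G \<subseteq> verts G \<times> verts G \<and> root G \<in> verts G \<and>
     (\<forall>u. (u, root G) \<notin> edges G) \<and>
     (\<forall>v \<in> verts G - {root G}. \<exists>!u. (u, v) \<in> edges G) \<and>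
     (\<forall>v \<in> verts G. (root G, v) \<in> (edges G)\<^sup>*)"

definition level :: "('a, 'b) binary_tree_scheme \<Rightarrow> 'a \<Rightarrow> nat" where
  "level G v = (LEAST d. (root G, v) \<in> edges G ^^ d)"

definition children :: "('a, 'b) graph_scheme \<Rightarrow> 'a \<Rightarrow> 'a set" where
  "children G u = {v. (u, v) \<in> edges G}"

text \<open>The values of \<open>left\<close> and \<open>right\<close> matter only at non-leaf vertices.\<close>

definition regular_binary_tree :: "('a, 'b) binary_tree_scheme \<Rightarrow> nat \<Rightarrow> bool" where
  "regular_binary_tree G h \<longleftrightarrow>
     rooted_tree G \<and>
     (\<forall>v \<in> verts G. children G v \<noteq> {} \<longrightarrow>
        left G v \<noteq> right G v \<and> children G v = {left G v, right G v}) \<and>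
     (\<forall>v \<in> verts G. children G v = {} \<longrightarrow> level G v = h)"

definition period :: "nat \<Rightarrow> nat \<Rightarrow> nat" where
  "period h k' = h - k' + 2"

definition num_bands :: "nat \<Rightarrow> nat \<Rightarrow> nat" where
  "num_bands h k' = (h + 1) div period h k' - 1"

definition step1_cut :: "('a, 'b) binary_tree_scheme \<Rightarrow> nat \<Rightarrow> nat \<Rightarrow> ('a \<times> 'a) set" where
  "step1_cut G h k' =
     {(u, v). (u, v) \<in> edges G \<and>
        (\<exists>i \<in> {1..num_bands h k'}.
           level G u = h - i * period h k' \<and> level G v = h - i * period h k' + 1)}"

text \<open>The vertices lying below \<open>v\<close> (including \<open>v\<close>) in the component of \<open>v\<close> that
  remains after Step 1. For \<open>v\<close> a child of the root of such a component, or of one of the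
  vertices considered in Step 3, this is the basic subtree named in the algorithm.\<close>

definition subtree1 :: "('a, 'b) binary_tree_scheme \<Rightarrow> nat \<Rightarrow> nat \<Rightarrow> 'a \<Rightarrow> 'a set" where
  "subtree1 G h k' v = (edges G - step1_cut G h k')\<^sup>* `` {v}"

definition left_sub :: "('a, 'b) binary_tree_scheme \<Rightarrow> nat \<Rightarrow> nat \<Rightarrow> 'a \<Rightarrow> 'a set" where
  "left_sub G h k' v = subtree1 G h k' (left G v)"

definition right_sub :: "('a, 'b) binary_tree_scheme \<Rightarrow> nat \<Rightarrow> nat \<Rightarrow> 'a \<Rightarrow> 'a set" where
  "right_sub G h k' v = subtree1 G h k' (right G v)"

definition band_roots :: "('a, 'b) binary_tree_scheme \<Rightarrow> nat \<Rightarrow> nat \<Rightarrow> 'a set" where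
  "band_roots G h k' = snd ` step1_cut G h k'"

text \<open>\<open>S\<close> is the set of roots of the band trees whose right basic subtrees are split into
  isolated vertices, and \<open>f\<close> pairs these vertices with the other right basic subtrees
  (given by the roots of their band trees). The division defining \<open>q\<close> is exact.\<close>

definition step2_partition ::
    "('a, 'b) binary_tree_scheme \<Rightarrow> nat \<Rightarrow> nat \<Rightarrow> 'a set set \<Rightarrow> bool" where
  "step2_partition G h k' P \<longleftrightarrow>
     (let R = band_roots G h k';
          p = card R;
          q = ((2 ^ (h - k' + 1) - 1) * p) div 2 ^ (h - k' + 1)
      in \<exists>S f. S \<subseteq> R \<and> card S = p - q \<and>
           bij_betw f (\<Union>r\<in>S. right_sub G h k' r) (R - S) \<and>
           P = (\<lambda>r. insert r (left_sub G h k' r)) ` R \<union>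
               (\<lambda>w. insert w (right_sub G h k' (f w))) ` (\<Union>r\<in>S. right_sub G h k' r))"

text \<open>Here \<open>L = h - (e + 1) t + 1\<close>, arranged so that subtraction on \<open>nat\<close> does not
  truncate. The vertices of level less than \<open>L\<close> are paired by \<open>g\<close> with right basic subtrees
  (given by the parents of their roots), and the right basic subtree left over, that of \<open>s\<close>,
  is the small partition set.\<close>

definition step3_partition ::
    "('a, 'b) binary_tree_scheme \<Rightarrow> nat \<Rightarrow> nat \<Rightarrow> 'a set set \<Rightarrow> bool" where
  "step3_partition G h k' P \<longleftrightarrow>
     (let L = h + 1 - (num_bands h k' + 1) * period h k';
          U = {u \<in> verts G. level G u = L};
          X = {x \<in> verts G. level G x < L}
      in \<exists>s g. s \<in> U \<and> bij_betw g X (U - {s}) \<and>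
           P = (\<lambda>u. insert u (left_sub G h k' u)) ` U \<union>
               (\<lambda>x. insert x (right_sub G h k' (g x))) ` X \<union>
               {right_sub G h k' s})"

text \<open>The algorithm leaves some choices open, so its results are given by a predicate.\<close>

definition algorithm_partition ::
    "('a, 'b) binary_tree_scheme \<Rightarrow> nat \<Rightarrow> nat \<Rightarrow> 'a set set \<Rightarrow> bool" where
  "algorithm_partition G h k' P \<longleftrightarrow>
     (\<exists>P2 P3. step2_partition G h k' P2 \<and> step3_partition G h k' P3 \<and> P = P2 \<union> P3)"

end

theory Submission
  imports Defs
begin

text \<open>
  Write \<open>m = h - k' + 1\<close> and \<open>t = m + 1\<close>. Since \<open>n = k \<cdot> 2\<^sup>m - 1\<close>, a partition into \<open>k\<close> sets of at
  most \<open>2\<^sup>m\<close> vertices is balanced with one unit of slack: all sets have exactly \<open>2\<^sup>m\<close> vertices, except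
  for one that has \<open>2\<^sup>m - 1\<close>.

  Every cut edge is the edge above a vertex whose parent lies in a different set. Such a vertex, and
  also the root of the tree, is a \<^emph>\<open>top\<close> of its set; the number of tops of a set is its number of
  connected components. Hence the cut value is the total number of tops minus one
  (\<open>cut_value_tops\<close>), and minimising it means making as many sets as possible connected.

  Call a vertex a \<^emph>\<open>hub\<close> if its level is congruent to \<open>h + 1\<close> modulo \<open>t\<close>. Between two successive hub
  levels there are only \<open>m\<close> levels, and there are at most \<open>m\<close> above the first and below the last, so a
  connected set without a hub has at most \<open>2\<^sup>m - 1\<close> vertices (\<open>card_hub_free\<close>). A connected set of
  \<open>2\<^sup>m\<close> vertices therefore uses up a hub. With \<open>H\<close> hubs, at most \<open>H + 1\<close> sets of a balanced partition
  are connected, the extra one being the small set, and all others have at least two tops. This gives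
  the lower bound \<open>2k - H - 2\<close> for every balanced partition (\<open>cut_value_lower_bound\<close>).

  The algorithm attains this bound. The hubs are exactly the roots of the bands together with the
  vertices considered in Step 3; each of them heads a connected set of \<open>2\<^sup>m\<close> vertices, and every other
  set, apart from the small one, has at most two tops (\<open>algorithm_balanced_cut\<close>). The sets cover the
  tree and there are at most \<open>k\<close> of them, all of size at most \<open>2\<^sup>m\<close> and one of them smaller; comparing
  with \<open>n\<close> shows that there is no room for overlaps, so that they form a balanced partition
  (\<open>partition_by_counting\<close>).

  Thus the optimal value is \<open>2k - H - 2\<close>. Summing the geometric series of the sizes of the hub levels
  gives \<open>(2\<^sup>t - 1) H = k \<cdot> 2\<^sup>m - 2\<^sup>L\<close>, where \<open>L\<close> is the topmost hub level, and the three claims are the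
  cases \<open>m \<ge> 2\<close>, \<open>m = 1\<close>, and only one hub level.
\<close>

definition tops :: "('a, 'b) graph_scheme \<Rightarrow> 'a set \<Rightarrow> 'a set" where
  "tops G A = {v \<in> A. \<forall>u \<in> A. (u, v) \<notin> edges G}"

section \<open>Levels of a regular binary tree\<close>

locale regular_tree =
  fixes G :: "('a, 'b) binary_tree_scheme" and h :: nat
  assumes regular: "regular_binary_tree G h"
begin

abbreviation "V \<equiv> verts G"
abbreviation "E \<equiv> edges G"
abbreviation "lev \<equiv> level G"

lemma rooted: "rooted_tree G"
  using regular by (simp add: regular_binary_tree_def)

lemma finite_V [simp]: "finite V"
  and E_subset: "E \<subseteq> V \<times> V"
  and root_in_V [simp]: "root G \<in> V"
  and no_parent_root: "(u, root G) \<notin> E"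
  using rooted by (auto simp: rooted_tree_def)

lemma edge_verts: "(u, v) \<in> E \<Longrightarrow> u \<in> V" "(u, v) \<in> E \<Longrightarrow> v \<in> V"
  using E_subset by auto

lemma parent_exists: "v \<in> V \<Longrightarrow> v \<noteq> root G \<Longrightarrow> \<exists>u. (u, v) \<in> E"
  using rooted unfolding rooted_tree_def by blast

lemma parent_unique: "(u, v) \<in> E \<Longrightarrow> (u', v) \<in> E \<Longrightarrow> u = u'"
  using rooted no_parent_root edge_verts(2)[of u v]
  unfolding rooted_tree_def by (metis DiffI singletonD)

lemma depth_unique:
  "(root G, v) \<in> E ^^ d \<Longrightarrow> (root G, v) \<in> E ^^ d' \<Longrightarrow> d = d'"
proof (induction d arbitrary: v d')
  case 0
  then show ?case
    using no_parent_root by (cases d') auto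
next
  case (Suc d)
  then obtain u where u: "(root G, u) \<in> E ^^ d" "(u, v) \<in> E"
    by auto
  then obtain d'' where d'': "d' = Suc d''"
    using Suc.prems(2) no_parent_root by (cases d') auto
  then obtain u' where u': "(root G, u') \<in> E ^^ d''" "(u', v) \<in> E"
    using Suc.prems(2) by auto
  then show ?case
    using Suc.IH[OF u(1), of d''] parent_unique u(2) d'' by auto
qed

lemma level_eqI: "(root G, v) \<in> E ^^ d \<Longrightarrow> lev v = d"
  unfolding level_def by (rule Least_equality) (auto dest: depth_unique)

lemma level_path: "v \<in> V \<Longrightarrow> (root G, v) \<in> E ^^ lev v"
proof -
  assume "v \<in> V"
  then have "(root G, v) \<in> E\<^sup>*"
    using rooted by (auto simp: rooted_tree_def)
  then obtain d where "(root G, v) \<in> E ^^ d"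
    using rtrancl_power by blast
  then show ?thesis
    using level_eqI by auto
qed

lemma level_edge: "(u, v) \<in> E \<Longrightarrow> lev v = Suc (lev u)"
  using level_path[OF edge_verts(1), of u v] by (intro level_eqI) auto

lemma level_root [simp]: "lev (root G) = 0"
  by (rule level_eqI) simp

lemma level_eq_0: "v \<in> V \<Longrightarrow> lev v = 0 \<longleftrightarrow> v = root G"
  using level_path by fastforce

lemma level_le:
  assumes "v \<in> V" shows "lev v \<le> h"
proof -
  have "Max (lev ` V) \<in> lev ` V"
    using finite_V root_in_V by (metis Max_in empty_iff finite_imageI image_is_empty)
  then obtain w where "w \<in> V" "lev w = Max (lev ` V)"
    by auto
  then have w: "w \<in> V" "\<forall>x \<in> V. lev x \<le> lev w"
    by auto
  have "children G w = {}"
    using w edge_verts(2) level_edge unfolding children_def by fastforce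
  then have "lev w = h"
    using regular w(1) by (auto simp: regular_binary_tree_def)
  then show ?thesis
    using w(2) assms by auto
qed

lemma children_cases:
  assumes "v \<in> V" "lev v < h"
  shows "left G v \<noteq> right G v" "children G v = {left G v, right G v}"
  using regular assms unfolding regular_binary_tree_def by fastforce+

lemma left_edge: "v \<in> V \<Longrightarrow> lev v < h \<Longrightarrow> (v, left G v) \<in> E"
  and right_edge: "v \<in> V \<Longrightarrow> lev v < h \<Longrightarrow> (v, right G v) \<in> E"
  using children_cases unfolding children_def by blast+

lemma edge_left_or_right: "(u, v) \<in> E \<Longrightarrow> v = left G u \<or> v = right G u"
  using children_cases[OF edge_verts(1), of u v] level_edge[of u v] level_le[of v] edge_verts(2)[of u v]
  unfolding children_def by auto

lemma card_level: "d \<le> h \<Longrightarrow> card {v \<in> V. lev v = d} = 2 ^ d"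
proof (induction d)
  case 0
  have "{v \<in> V. lev v = 0} = {root G}"
    using level_eq_0 by auto
  then show ?case by simp
next
  case (Suc d)
  let ?D = "{v \<in> V. lev v = d}"
  have "{v \<in> V. lev v = Suc d} = (\<Union>u \<in> ?D. children G u)"
  proof (intro equalityI subsetI)
    fix v assume v: "v \<in> {v \<in> V. lev v = Suc d}"
    then obtain u where "(u, v) \<in> E"
      using parent_exists[of v] by fastforce
    then show "v \<in> (\<Union>u \<in> ?D. children G u)"
      using v level_edge[of u v] edge_verts unfolding children_def by auto
  qed (auto simp: children_def level_edge edge_verts)
  also have "card \<dots> = (\<Sum>u \<in> ?D. card (children G u))"
  proof (rule card_UN_disjoint)
    show "\<forall>u \<in> ?D. finite (children G u)"
      using Suc.prems children_cases by simp
    show "\<forall>u \<in> ?D. \<forall>u' \<in> ?D. u \<noteq> u' \<longrightarrow> children G u \<inter> children G u' = {}"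
      using parent_unique unfolding children_def by blast
  qed simp
  also have "\<dots> = (\<Sum>u \<in> ?D. 2)"
    using Suc.prems children_cases by (intro sum.cong) auto
  finally show ?case
    using Suc by simp
qed

lemma sum_exp2: "(\<Sum>j<n. 2 ^ j) = 2 ^ n - (1::nat)"
  by (simp add: mask_eq_sum_exp_nat lessThan_def)

lemma card_levels: "n \<le> Suc h \<Longrightarrow> card {v \<in> V. lev v < n} = 2 ^ n - 1"
proof -
  assume "n \<le> Suc h"
  have "{v \<in> V. lev v < n} = (\<Union>d<n. {v \<in> V. lev v = d})"
    by auto
  also have "card \<dots> = (\<Sum>d<n. card {v \<in> V. lev v = d})"
    by (rule card_UN_disjoint) auto
  also have "\<dots> = (\<Sum>d<n. 2 ^ d)"
    using \<open>n \<le> Suc h\<close> by (intro sum.cong) (auto simp: card_level)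
  finally show ?thesis
    by (simp add: sum_exp2)
qed

lemma card_V: "card V = 2 ^ Suc h - 1"
proof -
  have "{v \<in> V. lev v < Suc h} = V"
    using level_le by (auto simp: less_Suc_eq_le)
  then show ?thesis
    using card_levels[of "Suc h"] by (simp del: power_Suc)
qed

lemma card_descendants:
  "finite {v. (a, v) \<in> E ^^ j} \<and> card {v. (a, v) \<in> E ^^ j} \<le> 2 ^ j"
proof (induction j)
  case (Suc j)
  let ?D = "{v. (a, v) \<in> E ^^ j}"
  have sub: "{v. (a, v) \<in> E ^^ Suc j} \<subseteq> left G ` ?D \<union> right G ` ?D"
    using edge_left_or_right by auto
  have "card {v. (a, v) \<in> E ^^ Suc j} \<le> card (left G ` ?D \<union> right G ` ?D)"
    using sub Suc by (intro card_mono) auto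
  also have "\<dots> \<le> card (left G ` ?D) + card (right G ` ?D)"
    by (rule card_Un_le)
  also have "\<dots> \<le> card ?D + card ?D"
    using Suc by (intro add_mono card_image_le) auto
  finally show ?case
    using Suc sub by (auto intro: finite_subset)
qed auto

section \<open>Cut edges and tops\<close>

lemma tops_nonempty:
  assumes "A \<subseteq> V" "A \<noteq> {}" shows "tops G A \<noteq> {}"
proof -
  obtain a where a: "a \<in> A" "\<And>x. x \<in> A \<Longrightarrow> lev a \<le> lev x"
    using assms(2) exists_least_iff[of "\<lambda>n. \<exists>x \<in> A. lev x = n"] by (metis ex_in_conv not_le)
  then have "a \<in> tops G A"
    unfolding tops_def using level_edge by fastforce
  then show ?thesis by auto
qed

text \<open>Sending a cut edge to its lower end is injective, as parents are unique, and reaches every top of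
  a partition set except the root of the tree; the root accounts for the summand 1.\<close>

lemma cut_value_tops:
  assumes "partition_on V Q"
  shows "cut_value G Q + 1 = (\<Sum>A \<in> Q. card (tops G A))"
proof -
  let ?F = "{(u, v). (u, v) \<in> E \<and> (\<exists>A\<in>Q. \<exists>B\<in>Q. A \<noteq> B \<and> u \<in> A \<and> v \<in> B)}"
  let ?T = "\<Union>A \<in> Q. tops G A"
  have finQ: "finite Q"
    using assms finite_V by (rule finite_elements[rotated])
  have UQ: "\<Union>Q = V" and disj: "\<And>A B x. A \<in> Q \<Longrightarrow> B \<in> Q \<Longrightarrow> x \<in> A \<Longrightarrow> x \<in> B \<Longrightarrow> A = B"
    using assms unfolding partition_on_def disjoint_def by auto
  have finA: "finite A" if "A \<in> Q" for A
    using that UQ finite_V by (metis Union_upper finite_subset)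
  have inj: "inj_on snd ?F"
    using parent_unique by (auto simp: inj_on_def)
  have image: "snd ` ?F = ?T - {root G}"
  proof (intro equalityI subsetI)
    fix v assume "v \<in> snd ` ?F"
    then obtain u where "(u, v) \<in> ?F"
      by (metis (lifting) imageE prod.collapse)
    then obtain A B where uv: "(u, v) \<in> E" "A \<in> Q" "B \<in> Q" "A \<noteq> B" "u \<in> A" "v \<in> B"
      by blast
    then have "u \<notin> B"
      using disj[of A B u] by auto
    then have "v \<in> tops G B"
      using uv parent_unique unfolding tops_def by blast
    then show "v \<in> ?T - {root G}"
      using uv no_parent_root by auto
  next
    fix v assume "v \<in> ?T - {root G}"
    then obtain B where B: "B \<in> Q" "v \<in> tops G B" "v \<noteq> root G"
      by auto
    then have "v \<in> V"
      using UQ by (auto simp: tops_def)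
    then obtain u where u: "(u, v) \<in> E"
      using B(3) parent_exists by auto
    then obtain A where "A \<in> Q" "u \<in> A"
      using UQ edge_verts(1) by blast
    then have "(u, v) \<in> ?F"
      using B u by (auto simp: tops_def)
    then show "v \<in> snd ` ?F"
      by (rule rev_image_eqI) simp
  qed
  have "cut_value G Q = card (?T - {root G})"
    unfolding cut_value_def image[symmetric] by (rule card_image[OF inj, symmetric])
  moreover have "root G \<in> ?T"
    using UQ root_in_V no_parent_root by (fastforce simp: tops_def)
  moreover have finT: "finite ?T"
    using finQ finA by (auto simp: tops_def)
  ultimately have "cut_value G Q + 1 = card ?T"
    using card_Suc_Diff1 by fastforce
  also have "\<dots> = (\<Sum>A \<in> Q. card (tops G A))"
    using finQ finA disj by (intro card_UN_disjoint) (auto simp: tops_def)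
  finally show ?thesis .
qed

end

section \<open>Hubs and the lower bound\<close>

locale balanced_setting = regular_tree G h
  for G :: "('a, 'b) binary_tree_scheme" and h :: nat +
  fixes k' :: nat
  assumes k'_ge: "1 \<le> k'" and k'_le: "k' \<le> h"
begin

abbreviation "m \<equiv> h - k' + 1"
abbreviation "t \<equiv> period h k'"
abbreviation "e \<equiv> num_bands h k'"
abbreviation "L \<equiv> h + 1 - (e + 1) * t"

definition hubs :: "'a set" where
  "hubs = {v \<in> V. t dvd h + 1 - lev v}"

lemma t_eq: "t = Suc m"
  by (simp add: period_def)

lemma hubs_subset: "hubs \<subseteq> V"
  by (auto simp: hubs_def)

lemma finite_hubs [simp]: "finite hubs"
  using hubs_subset finite_V finite_subset by blast

lemma e_plus_1: "e + 1 = (h + 1) div t"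
proof -
  have "(h + 1) div t \<ge> 1"
    using k'_ge k'_le by (simp add: t_eq Suc_le_eq div_greater_zero_iff)
  then show ?thesis
    by (simp add: num_bands_def)
qed

lemma h_eq: "h + 1 = (e + 1) * t + L"
  unfolding e_plus_1 by simp

lemma L_mod: "L = (h + 1) mod t"
  unfolding e_plus_1 by (simp add: minus_div_mult_eq_mod)

lemma L_less_h: "L < h"
proof -
  have "t \<ge> 2" "(e + 1) * t \<ge> t" by (simp_all add: t_eq)
  then show ?thesis using h_eq by linarith
qed

lemma band_bound:
  assumes "i \<in> {1..e}" shows "i * t + t + L \<le> h + 1"
proof -
  have "(i + 1) * t \<le> (e + 1) * t"
    using assms by (intro mult_le_mono1) auto
  moreover have "(i + 1) * t = i * t + t"
    by simp
  ultimately show ?thesis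
    using h_eq by linarith
qed

lemma exp_h: "(2::nat) ^ (h + 1) = 2 ^ k' * 2 ^ m"
  using k'_le by (simp flip: power_add)

lemma card_V_eq: "card V + 1 = 2 ^ k' * 2 ^ m"
  using card_V exp_h by simp

text \<open>A nonempty \<open>B\<close> is connected, with \<open>a\<close> as its uppermost vertex. The first hub level at or below
  \<open>a\<close> lies \<open>(h + 1 - lev a) mod t\<close> levels further down (or is the fictitious level \<open>h + 1\<close> below the
  leaves), and \<open>B\<close> cannot pass it. So \<open>B\<close> lies within at most \<open>m\<close> generations of descendants of \<open>a\<close>.\<close>

lemma card_hub_free:
  assumes B: "B \<subseteq> V" "B \<inter> hubs = {}" and top: "tops G B \<subseteq> {a}"
  shows "card B < 2 ^ m"
proof -
  let ?x = "(h + 1 - lev a) mod t"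
  have reach: "\<exists>j < ?x. (a, v) \<in> E ^^ j" if "v \<in> B" for v
    using that
  proof (induction "lev v" arbitrary: v rule: less_induct)
    case less
    show ?case
    proof (cases "v = a")
      case True
      then have "?x > 0"
        using less.prems B by (auto simp: hubs_def mod_eq_0_iff_dvd intro!: Nat.gr0I)
      then show ?thesis
        using True by (intro exI[of _ 0]) auto
    next
      case False
      then obtain u where u: "u \<in> B" "(u, v) \<in> E"
        using top less.prems by (auto simp: tops_def)
      then obtain j where j: "j < ?x" "(a, u) \<in> E ^^ j"
        using less.hyps[of u] level_edge by auto
      have path: "(a, v) \<in> E ^^ Suc j"
        using j(2) u(2) by auto
      have lev_desc: "lev w = lev a + i" if "(a, w) \<in> E ^^ i" for w i
        using that by (induction i arbitrary: w) (auto simp: level_edge)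
      \<comment> \<open>A vertex \<open>?x\<close> generations below \<open>a\<close> would be a hub.\<close>
      have "Suc j \<noteq> ?x"
      proof
        assume "Suc j = ?x"
        then have "h + 1 - lev v = h + 1 - lev a - (h + 1 - lev a) mod t"
          using lev_desc[OF path] by simp
        then have "t dvd h + 1 - lev v"
          using dvd_minus_mod by (simp only:)
        then show False
          using B less.prems by (auto simp: hubs_def)
      qed
      then show ?thesis
        using path j(1) by (intro exI[of _ "Suc j"]) auto
    qed
  qed
  have "?x \<le> m"
    using t_eq by (metis less_Suc_eq_le mod_less_divisor zero_less_Suc)
  then have sub: "B \<subseteq> (\<Union>j<m. {v. (a, v) \<in> E ^^ j})"
    using reach by fastforce
  have "card B \<le> card (\<Union>j<m. {v. (a, v) \<in> E ^^ j})"
    using sub card_descendants by (intro card_mono) auto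
  also have "\<dots> \<le> (\<Sum>j<m. card {v. (a, v) \<in> E ^^ j})"
    by (rule card_UN_le) simp
  also have "\<dots> \<le> (\<Sum>j<m. 2 ^ j)"
    using card_descendants by (intro sum_mono) auto
  also have "\<dots> = 2 ^ m - 1"
    by (rule sum_exp2)
  finally show ?thesis
    by (metis diff_less le_less_trans less_numeral_extra(1) zero_less_numeral zero_less_power)
qed

lemma ceiling_bound: "\<lceil>real (card V) / real (2 ^ k')\<rceil> = 2 ^ m"
proof -
  have "real (card V) = 2 ^ k' * 2 ^ m - 1"
    using arg_cong[OF card_V_eq, of real] by simp
  then have "real (card V) / real (2 ^ k') = 2 ^ m - 1 / 2 ^ k'"
    by (simp add: field_simps)
  moreover have "1 / (2::real) ^ k' \<le> 1" "1 / (2::real) ^ k' < 1" "1 / (2::real) ^ k' > 0"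
    using k'_ge by (auto simp: field_simps)
  ultimately show ?thesis
    by (intro ceiling_unique) auto
qed

lemma balanced_iff:
  "balanced_partition G (2 ^ k') Q \<longleftrightarrow>
     partition_on V Q \<and> card Q = 2 ^ k' \<and> (\<forall>A \<in> Q. card A \<le> 2 ^ m)"
proof -
  have "int (card A) \<le> 2 ^ m \<longleftrightarrow> card A \<le> 2 ^ m" for A :: "'a set"
    by (metis of_nat_le_iff of_nat_numeral of_nat_power)
  then show ?thesis
    unfolding balanced_partition_def ceiling_bound by simp
qed

text \<open>For every partition set, the number of tops, the number of hubs and the number of vertices missing
  from \<open>2\<^sup>m\<close> add up to at least 2: if there is just one top and no hub, the set is too small by
  \<open>card_hub_free\<close>. Summing over all sets, the hubs contribute \<open>card hubs\<close> and the missing vertices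
  contribute 1.\<close>

lemma cut_value_lower_bound:
  assumes "balanced_partition G (2 ^ k') Q"
  shows "2 * 2 ^ k' \<le> cut_value G Q + card hubs + 2"
proof -
  have Q: "partition_on V Q" "card Q = 2 ^ k'" "\<And>A. A \<in> Q \<Longrightarrow> card A \<le> 2 ^ m"
    using assms by (auto simp: balanced_iff)
  have finQ: "finite Q"
    using Q(1) finite_V by (rule finite_elements[rotated])
  have sub: "A \<subseteq> V" and finA: "finite A" and ne: "A \<noteq> {}" if "A \<in> Q" for A
    using that Q(1) finite_V by (auto simp: partition_on_def intro: finite_subset)
  have disj: "\<And>A B. A \<in> Q \<Longrightarrow> B \<in> Q \<Longrightarrow> A \<noteq> B \<Longrightarrow> A \<inter> B = {}" and UQ: "\<Union>Q = V"
    using Q(1) by (auto simp: partition_on_def disjoint_def)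
  have loc: "2 \<le> card (tops G A) + card (A \<inter> hubs) + (2 ^ m - card A)" if A: "A \<in> Q" for A
  proof -
    have fin: "finite (tops G A)" "finite (A \<inter> hubs)"
      using finA[OF A] by (auto simp: tops_def)
    have pos: "card (tops G A) \<noteq> 0"
      using tops_nonempty[OF sub[OF A] ne[OF A]] fin(1) by simp
    show ?thesis
    proof (cases "card (tops G A) = 1 \<and> A \<inter> hubs = {}")
      case True
      then obtain a where "tops G A = {a}"
        by (auto simp: card_1_singleton_iff)
      then have "card A < 2 ^ m"
        using card_hub_free[of A a] sub[OF A] True by auto
      then show ?thesis
        using pos by linarith
    next
      case False
      then have "card (tops G A) \<noteq> 1 \<or> card (A \<inter> hubs) \<noteq> 0"
        using fin by auto
      then show ?thesis
        using pos by linarith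
    qed
  qed
  have "(\<Sum>A \<in> Q. card A) = card V"
    using product_partition[OF Q(1)] finA by simp
  moreover have "(\<Sum>A \<in> Q. 2 ^ m - card A) + (\<Sum>A \<in> Q. card A) = (\<Sum>A \<in> Q. 2 ^ m)"
    unfolding sum.distrib[symmetric] using Q(3) by (intro sum.cong) auto
  moreover have "(\<Sum>A \<in> Q. 2 ^ m) = (2::nat) ^ k' * 2 ^ m"
    by (simp add: Q(2))
  ultimately have slack: "(\<Sum>A \<in> Q. 2 ^ m - card A) = 1"
    using card_V_eq by linarith
  have "(\<Sum>A \<in> Q. card (A \<inter> hubs)) = card (\<Union>A \<in> Q. A \<inter> hubs)"
    using finQ finA disj by (intro card_UN_disjoint[symmetric]) auto
  also have "(\<Union>A \<in> Q. A \<inter> hubs) = hubs"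
    using UQ hubs_subset by auto
  finally have hub: "(\<Sum>A \<in> Q. card (A \<inter> hubs)) = card hubs" .
  have "2 * 2 ^ k' = (\<Sum>A \<in> Q. 2::nat)"
    using Q(2) by simp
  also have "\<dots> \<le> (\<Sum>A \<in> Q. card (tops G A) + card (A \<inter> hubs) + (2 ^ m - card A))"
    using loc by (intro sum_mono) auto
  also have "\<dots> = cut_value G Q + 1 + card hubs + 1"
    by (simp only: sum.distrib hub slack cut_value_tops[OF Q(1)])
  finally show ?thesis
    by simp
qed


section \<open>Counting the hubs\<close>

abbreviation "R \<equiv> band_roots G h k'"
abbreviation "U \<equiv> {u \<in> V. lev u = L}"

lemma band_roots_levels: "R = (\<Union>i \<in> {1..e}. {v \<in> V. lev v = h + 1 - i * t})"
proof (intro equalityI subsetI)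
  have it: "i * t \<le> h" if "i \<in> {1..e}" for i
    using band_bound[OF that] t_eq by linarith
  fix v
  {
    assume "v \<in> R"
    then obtain u i where "(u, v) \<in> E" "i \<in> {1..e}" "lev v = h - i * t + 1"
      unfolding band_roots_def step1_cut_def by auto
    moreover from this have "lev v = h + 1 - i * t"
      using it[of i] by simp
    ultimately show "v \<in> (\<Union>i \<in> {1..e}. {v \<in> V. lev v = h + 1 - i * t})"
      using edge_verts(2) by blast
  next
    assume "v \<in> (\<Union>i \<in> {1..e}. {v \<in> V. lev v = h + 1 - i * t})"
    then obtain i where i: "i \<in> {1..e}" "v \<in> V" "lev v = h - i * t + 1"
      using it by (auto simp: Suc_diff_le)
    then obtain u where "(u, v) \<in> E"
      using parent_exists[of v] by fastforce
    then have "(u, v) \<in> step1_cut G h k'"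
      using i level_edge[of u v] unfolding step1_cut_def by auto
    then show "v \<in> R"
      unfolding band_roots_def by force
  }
qed

lemma hubs_levels: "hubs = (\<Union>i \<in> {1..e + 1}. {v \<in> V. lev v = h + 1 - i * t})"
proof (intro equalityI subsetI)
  fix v assume v: "v \<in> hubs"
  then obtain i where i: "h + 1 - lev v = i * t" and vV: "v \<in> V"
    by (auto simp: hubs_def dvd_def mult.commute)
  have le: "lev v \<le> h"
    using level_le[OF vV] .
  have "i \<noteq> 0"
    using i le by (intro notI) simp
  moreover have "i \<le> e + 1"
    using i unfolding e_plus_1 by (metis diff_le_self div_le_mono nonzero_mult_div_cancel_right t_eq nat.simps(3))
  moreover have "lev v = h + 1 - i * t"
    using i le by linarith
  ultimately show "v \<in> (\<Union>i \<in> {1..e + 1}. {v \<in> V. lev v = h + 1 - i * t})"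
    using vV by auto
next
  fix v assume "v \<in> (\<Union>i \<in> {1..e + 1}. {v \<in> V. lev v = h + 1 - i * t})"
  then obtain i where i: "i \<le> e + 1" "v \<in> V" "lev v = h + 1 - i * t"
    by auto
  have "i * t \<le> (e + 1) * t"
    using i(1) by (rule mult_le_mono1)
  then have "h + 1 - lev v = i * t"
    using i(3) h_eq by linarith
  then show "v \<in> hubs"
    using i(2) by (simp add: hubs_def)
qed

lemma hubs_split: "hubs = R \<union> U"
  unfolding hubs_levels band_roots_levels by (simp add: atLeastAtMostSuc_conv Un_commute)

lemma hub_level: "u \<in> hubs \<Longrightarrow> L \<le> lev u" "u \<in> hubs \<Longrightarrow> lev u < h"
proof -
  assume "u \<in> hubs"
  then obtain i where i: "i \<in> {1..e + 1}" "lev u = h + 1 - i * t"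
    unfolding hubs_levels by auto
  have "i * t \<le> (e + 1) * t" "i * t \<ge> t"
    using i(1) by (auto intro!: mult_le_mono1 simp del: mult_Suc)
  then show "L \<le> lev u" "lev u < h"
    using i(2) h_eq t_eq k'_ge k'_le by linarith+
qed

lemma R_U_disjoint: "R \<inter> U = {}"
proof -
  have "h + 1 - i * t \<noteq> L" if "i \<in> {1..e}" for i
    using band_bound[OF that] t_eq by linarith
  then show ?thesis
    unfolding band_roots_levels by fastforce
qed

lemma card_U: "card U = 2 ^ L"
  using card_level L_less_h by simp

lemma card_hubs: "card hubs = card R + 2 ^ L"
  using hubs_split R_U_disjoint card_U finite_hubs
  by (metis card_Un_disjoint finite_Un)

lemma card_R: "card R = (\<Sum>i = 1..e. 2 ^ (h + 1 - i * t))"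
proof -
  have le: "i * t \<le> h" if "i \<in> {1..e}" for i
    using band_bound[OF that] t_eq by linarith
  have neq: "h + 1 - i * t \<noteq> h + 1 - j * t" if "i \<in> {1..e}" "j \<in> {1..e}" "i \<noteq> j" for i j
  proof -
    have "i * t \<noteq> j * t"
      using that(3) t_eq mult_cancel2 by (metis nat.simps(3))
    then show ?thesis
      using le[OF that(1)] le[OF that(2)] by linarith
  qed
  have "card R = (\<Sum>i = 1..e. card {v \<in> V. lev v = h + 1 - i * t})"
    unfolding band_roots_levels
  proof (rule card_UN_disjoint)
    show "\<forall>i \<in> {1..e}. \<forall>j \<in> {1..e}. i \<noteq> j \<longrightarrow>
        {v \<in> V. lev v = h + 1 - i * t} \<inter> {v \<in> V. lev v = h + 1 - j * t} = {}"
      using neq by fastforce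
  qed auto
  also have "\<dots> = (\<Sum>i = 1..e. 2 ^ (h + 1 - i * t))"
    using t_eq by (intro sum.cong refl card_level) (auto simp: Suc_le_eq le_diff_conv)
  finally show ?thesis .
qed

lemma level_sum:
  "n * t \<le> h + 1 \<Longrightarrow>
    2 ^ t * (\<Sum>i = 1..n. 2 ^ (h + 1 - i * t)) + 2 ^ (h + 1 - n * t)
      = 2 ^ (h + 1) + (\<Sum>i = 1..n. (2::nat) ^ (h + 1 - i * t))"
proof (induction n)
  case (Suc n)
  have "(2::nat) ^ t * 2 ^ (h + 1 - Suc n * t) = 2 ^ (t + (h + 1 - Suc n * t))"
    by (simp only: power_add)
  also have "t + (h + 1 - Suc n * t) = h + 1 - n * t"
    using Suc.prems by simp
  finally have "(2::nat) ^ t * 2 ^ (h + 1 - Suc n * t) = 2 ^ (h + 1 - n * t)" .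
  then show ?case
    using Suc by (simp add: algebra_simps del: power_Suc)
qed simp

text \<open>This is \<open>(2\<^sup>t - 1) p = 2\<^sup>h\<^sup>+\<^sup>1 - 2\<^sup>L\<^sup>+\<^sup>t\<close> for the number \<open>p\<close> of band roots, arranged without
  subtraction.\<close>

lemma card_R_eq: "2 * 2 ^ m * card R + 2 * 2 ^ m * 2 ^ L = 2 ^ k' * 2 ^ m + card R"
proof -
  have "h + 1 - e * t = t + L" "e * t \<le> h + 1"
    using h_eq by simp_all
  then have "2 ^ t * card R + 2 ^ (t + L) = 2 ^ (h + 1) + card R"
    using level_sum[of e] unfolding card_R by (simp only:)
  then show ?thesis
    unfolding t_eq exp_h by (simp add: power_add)
qed

lemma two_m_dvd_card_R: "2 ^ m dvd card R"
  unfolding card_R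
proof (intro dvd_sum le_imp_power_dvd)
  fix i assume "i \<in> {1..e}"
  from band_bound[OF this] show "m \<le> h + 1 - i * t"
    using t_eq by linarith
qed

definition q :: nat where
  "q = ((2 ^ m - 1) * card R) div 2 ^ m"

text \<open>The second equation counts the partition sets of the algorithm: \<open>p + q\<close> of them come from the
  bands, and \<open>2\<^sup>L + (2\<^sup>L - 1) + 1\<close> from the top part.\<close>

lemma q_le: "q \<le> card R"
  and k_eq: "card R + q + 2 * 2 ^ L = 2 ^ k'"
proof -
  obtain p' where p': "card R = 2 ^ m * p'"
    using two_m_dvd_card_R by (auto simp: dvd_def)
  have q: "q = (2 ^ m - 1) * p'"
    by (simp add: q_def p' mult.left_commute)
  show "q \<le> card R"
    by (simp add: q p')
  have "2 ^ m * (2 * (2 ^ m * p') + 2 * 2 ^ L) = 2 ^ m * (2 ^ k' + p')"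
    using card_R_eq p' by (simp add: algebra_simps)
  then have "2 * (2 ^ m * p') + 2 * 2 ^ L = 2 ^ k' + p'"
    by simp
  moreover have "q + p' = 2 ^ m * p'"
    unfolding q by (cases "(2::nat) ^ m") auto
  ultimately show "card R + q + 2 * 2 ^ L = 2 ^ k'"
    using p' by linarith
qed

section \<open>The partition computed by the algorithm\<close>

abbreviation "sub1 \<equiv> subtree1 G h k'"
abbreviation "lsub \<equiv> left_sub G h k'"
abbreviation "rsub \<equiv> right_sub G h k'"

lemma subtree_self: "a \<in> sub1 a"
  by (simp add: subtree1_def)

lemma subtree_step: "u \<in> sub1 a \<Longrightarrow> (u, v) \<in> E \<Longrightarrow> v \<notin> R \<Longrightarrow> v \<in> sub1 a"
  unfolding subtree1_def band_roots_def
  by (force intro: rtrancl_into_rtrancl)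

lemma subtree_parent: "v \<in> sub1 a \<Longrightarrow> v \<noteq> a \<Longrightarrow> \<exists>u \<in> sub1 a. (u, v) \<in> E"
  unfolding subtree1_def by (auto elim: rtranclE)

lemma tops_subtree: "tops G (sub1 a) \<subseteq> {a}"
  and tops_insert_subtree: "tops G (insert x (sub1 a)) \<subseteq> {x, a}"
  and tops_insert_child_subtree: "(x, a) \<in> E \<Longrightarrow> tops G (insert x (sub1 a)) \<subseteq> {x}"
  using subtree_parent[of _ a] unfolding tops_def by blast+

text \<open>All edges into hubs below the topmost hub level are cut in Step 1. A subtree that starts right below
  a hub thus contains no hub, and \<open>card_hub_free\<close> bounds its size.\<close>

lemma subtree_below_hub:
  assumes u: "u \<in> hubs" and a: "(u, a) \<in> E"
  shows "sub1 a \<subseteq> V" "card (sub1 a) < 2 ^ m"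
proof -
  have "v \<in> V \<and> L < lev v \<and> v \<notin> hubs" if "(a, v) \<in> (E - step1_cut G h k')\<^sup>*" for v
    using that
  proof (induction rule: rtrancl_induct)
    case base
    have "t dvd h + 1 - lev u"
      using u by (simp add: hubs_def)
    moreover have "h + 1 - lev u = Suc (h + 1 - lev a)"
      using level_edge[OF a] hub_level(2)[OF u] by simp
    moreover have "\<not> t dvd 1"
      by (simp add: t_eq)
    ultimately have "\<not> t dvd h + 1 - lev a"
      by (metis Suc_eq_plus1 dvd_add_right_iff)
    then show ?case
      using a level_edge[OF a] hub_level(1)[OF u] edge_verts(2) by (auto simp: hubs_def)
  next
    case (step x y)
    have "y \<notin> R"
    proof
      assume "y \<in> R"
      then obtain x' where "(x', y) \<in> step1_cut G h k'"
        by (auto simp: band_roots_def)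
      moreover from this have "x' = x"
        using step.hyps parent_unique by (auto simp: step1_cut_def)
      ultimately show False
        using step.hyps by auto
    qed
    then show ?case
      using step hubs_split level_edge[of x y] edge_verts(2)[of x y] by auto
  qed
  then have "sub1 a \<subseteq> V" "sub1 a \<inter> hubs = {}"
    by (auto simp: subtree1_def)
  then show "sub1 a \<subseteq> V" "card (sub1 a) < 2 ^ m"
    using card_hub_free tops_subtree by blast+
qed

lemma hub_edges: "u \<in> hubs \<Longrightarrow> (u, left G u) \<in> E" "u \<in> hubs \<Longrightarrow> (u, right G u) \<in> E"
  using hubs_subset hub_level(2) left_edge right_edge by blast+

lemma lsub_V: "u \<in> hubs \<Longrightarrow> lsub u \<subseteq> V" and card_lsub: "u \<in> hubs \<Longrightarrow> card (lsub u) < 2 ^ m"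
  and rsub_V: "u \<in> hubs \<Longrightarrow> rsub u \<subseteq> V" and card_rsub: "u \<in> hubs \<Longrightarrow> card (rsub u) < 2 ^ m"
  unfolding left_sub_def right_sub_def using hub_edges subtree_below_hub by blast+

text \<open>Walking up from \<open>v\<close> to the nearest hub uses only edges that Step 1 does not cut.\<close>

lemma hub_cover:
  "v \<in> V \<Longrightarrow> L \<le> lev v \<Longrightarrow> \<exists>a \<in> hubs. v = a \<or> v \<in> lsub a \<or> v \<in> rsub a"
proof (induction "lev v" arbitrary: v rule: less_induct)
  case less
  show ?case
  proof (cases "v \<in> hubs")
    case False
    then have "L < lev v"
      using less.prems hubs_split by (cases "lev v = L") auto
    then obtain u where u: "(u, v) \<in> E"
      using less.prems parent_exists[of v] level_root by fastforce
    then obtain a where a: "a \<in> hubs" "u = a \<or> u \<in> lsub a \<or> u \<in> rsub a"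
      using less.hyps[of u] \<open>L < lev v\<close> level_edge[OF u] edge_verts(1) by auto
    have "v \<notin> R"
      using False hubs_split by auto
    then have "v \<in> lsub a \<or> v \<in> rsub a"
      using a u edge_left_or_right[OF u] subtree_self subtree_step
      unfolding left_sub_def right_sub_def by blast
    then show ?thesis
      using a(1) by auto
  qed auto
qed

text \<open>Since \<open>n = k \<cdot> 2\<^sup>m - 1\<close>, at most \<open>k\<close> sets of size at most \<open>2\<^sup>m\<close>, one of them smaller, can cover the
  tree only if there are exactly \<open>k\<close> of them and their sizes add up to exactly \<open>n\<close>; then no vertex is
  covered twice. Counting thus replaces a comparison of the sets of the algorithm in pairs.\<close>

lemma partition_by_counting:
  assumes fin: "finite P" and cover: "\<Union>P = V" and ne: "{} \<notin> P"
    and card_P: "card P \<le> 2 ^ k'" and size: "\<And>A. A \<in> P \<Longrightarrow> card A \<le> 2 ^ m"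
    and small: "B \<in> P" "card B < 2 ^ m"
  shows "balanced_partition G (2 ^ k') P"
proof -
  have finA: "finite A" if "A \<in> P" for A
    using that cover finite_V by (metis Union_upper finite_subset)
  have "(\<Sum>A \<in> P. card A) < (\<Sum>A \<in> P. 2 ^ m)"
    using fin size small by (intro sum_strict_mono_ex1) auto
  then have total: "(\<Sum>A \<in> P. card A) + 1 \<le> card P * 2 ^ m"
    by simp
  have V_le: "card V \<le> (\<Sum>A \<in> P. card A)"
    unfolding cover[symmetric] using card_Union_le_sum_card .
  have "2 ^ k' * 2 ^ m \<le> card P * 2 ^ m"
    using total V_le card_V_eq by linarith
  then have k: "card P = 2 ^ k'"
    using card_P by simp
  have sum_eq: "(\<Sum>A \<in> P. card A) = card V"
    using total V_le card_V_eq k by simp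
  have "disjoint P"
  proof (rule disjointI)
    fix A B assume AB: "A \<in> P" "B \<in> P" "A \<noteq> B"
    have "card V = card (A \<union> \<Union>(P - {A}))"
      using cover AB(1) by (intro arg_cong[where f = card]) auto
    moreover have "card (A \<union> \<Union>(P - {A})) + card (A \<inter> \<Union>(P - {A})) = card A + card (\<Union>(P - {A}))"
      using fin finA AB(1) by (intro card_Un_Int[symmetric]) auto
    moreover have "card (\<Union>(P - {A})) \<le> (\<Sum>C \<in> P - {A}. card C)"
      by (rule card_Union_le_sum_card)
    moreover have "(\<Sum>C \<in> P. card C) = card A + (\<Sum>C \<in> P - {A}. card C)"
      using fin AB(1) by (rule sum.remove)
    ultimately have "card (A \<inter> \<Union>(P - {A})) = 0"
      using sum_eq by linarith
    then have "A \<inter> \<Union>(P - {A}) = {}"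
      using finA[OF AB(1)] by simp
    then show "A \<inter> B = {}"
      using AB by blast
  qed
  then show ?thesis
    using balanced_iff cover ne k size by (auto simp: partition_on_def)
qed

text \<open>The partition falls into the sets \<open>C\<close> with a single top (a hub with its left subtree, or the small
  set) and the sets \<open>D\<close> composed of a vertex and a right subtree elsewhere, which have at most two
  tops. As \<open>D\<close> has at most \<open>q + 2\<^sup>L - 1\<close> members, the cut value is at most \<open>k + q + 2\<^sup>L - 2\<close>, which is
  \<open>2k - H - 2\<close> for the number \<open>H = p + 2\<^sup>L\<close> of hubs.\<close>

lemma algorithm_balanced_cut:
  assumes "algorithm_partition G h k' P"
  shows "balanced_partition G (2 ^ k') P"
    and "cut_value G P + card hubs + 2 \<le> 2 * 2 ^ k'"
proof -
  define X where "X = {x \<in> V. lev x < L}"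
  obtain S f s g where
    S: "S \<subseteq> R" "card S = card R - q" and f: "bij_betw f (\<Union>r\<in>S. rsub r) (R - S)" and
    s: "s \<in> U" and g: "bij_betw g X (U - {s})" and
    P: "P = ((\<lambda>r. insert r (lsub r)) ` R \<union>
             (\<lambda>w. insert w (rsub (f w))) ` (\<Union>r\<in>S. rsub r)) \<union>
            ((\<lambda>u. insert u (lsub u)) ` U \<union> (\<lambda>x. insert x (rsub (g x))) ` X \<union> {rsub s})"
    using assms unfolding algorithm_partition_def step2_partition_def step3_partition_def
      X_def q_def Let_def by blast
  define W where "W = (\<Union>r\<in>S. rsub r)"
  define C where "C = (\<lambda>u. insert u (lsub u)) ` hubs \<union> {rsub s}"
  define D where "D = (\<lambda>w. insert w (rsub (f w))) ` W \<union> (\<lambda>x. insert x (rsub (g x))) ` X"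
  have P_eq: "P = C \<union> D"
    unfolding P C_def D_def W_def hubs_split by (auto simp: image_Un)
  have fW: "f ` W = R - S" and gX: "g ` X = U - {s}"
    using f g unfolding W_def by (auto simp: bij_betw_def)
  have R_hubs: "R \<subseteq> hubs" and U_hubs: "U \<subseteq> hubs"
    using hubs_split by auto
  have f_hub: "f w \<in> hubs" if "w \<in> W" for w
    using that fW R_hubs by blast
  have g_hub: "g x \<in> hubs" if "x \<in> X" for x
    using that gX U_hubs by blast
  have s_hub: "s \<in> hubs"
    using s U_hubs by blast
  have W_V: "W \<subseteq> V"
    using S R_hubs rsub_V unfolding W_def by blast
  have X_V: "X \<subseteq> V"
    by (auto simp: X_def)
  have finR: "finite R"
    using R_hubs finite_hubs finite_subset by blast
  have finWX: "finite W" "finite X"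
    using W_V X_V finite_V finite_subset by blast+
  have finCD: "finite C" "finite D"
    using finWX by (simp_all add: C_def D_def)
  have card_W: "card W = q"
    using bij_betw_same_card[OF f] S q_le finR unfolding W_def
    by (simp add: card_Diff_subset finite_subset)
  have card_X: "card X + 1 = 2 ^ L"
    using bij_betw_same_card[OF g] s card_U by (simp add: card_Diff_singleton)
  have card_C: "card C \<le> card hubs + 1"
    unfolding C_def by (intro order.trans[OF card_Un_le] add_mono card_image_le) auto
  have card_D: "card D \<le> q + card X"
    unfolding D_def card_W[symmetric]
    using finWX by (intro order.trans[OF card_Un_le] add_mono card_image_le) auto
  have card_P: "card P \<le> 2 ^ k'"
    using card_Un_le[of C D] card_C card_D card_X card_hubs k_eq unfolding P_eq by linarith
  have insert_size: "card (insert x B) \<le> 2 ^ m" if "card B < 2 ^ m" for x and B :: "'a set"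
    using that card_insert_le_m1[of "2 ^ m" B x] by simp
  have size: "card A \<le> 2 ^ m" if "A \<in> P" for A
    using that insert_size card_lsub card_rsub f_hub g_hub s_hub
    unfolding P_eq C_def D_def by (force intro: less_imp_le)
  have "\<forall>u \<in> hubs. lsub u \<subseteq> V" "\<forall>w \<in> W. rsub (f w) \<subseteq> V" "\<forall>x \<in> X. rsub (g x) \<subseteq> V"
    using lsub_V rsub_V f_hub g_hub by blast+
  then have "\<Union>P \<subseteq> V"
    using hubs_subset rsub_V[OF s_hub] W_V X_V unfolding P_eq C_def D_def by blast
  moreover have "V \<subseteq> \<Union>P"
  proof
    fix v assume v: "v \<in> V"
    show "v \<in> \<Union>P"
    proof (cases "v \<in> X")
      case False
      then obtain a where a: "a \<in> hubs" "v = a \<or> v \<in> lsub a \<or> v \<in> rsub a"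
        using hub_cover[of v] v by (auto simp: X_def not_less)
      show ?thesis
      proof (cases "v \<in> rsub a")
        case True
        have "rsub a \<subseteq> \<Union>D" if "a \<in> f ` W \<or> a \<in> g ` X"
          using that unfolding D_def by blast
        moreover have "W \<subseteq> \<Union>D" "rsub s \<subseteq> \<Union>C"
          unfolding C_def D_def by blast+
        moreover have "v \<in> W" if "a \<in> S"
          using True that unfolding W_def by blast
        moreover have "a \<in> S \<or> a \<in> f ` W \<or> a \<in> g ` X \<or> a = s"
          using a(1) hubs_split fW gX by blast
        ultimately have "v \<in> \<Union>C \<union> \<Union>D"
          using True by (elim disjE) auto
        then show ?thesis
          unfolding P_eq by simp
      qed (use a in \<open>auto simp: P_eq C_def\<close>)
    qed (auto simp: P_eq D_def)
  qed
  ultimately have cover: "\<Union>P = V" ..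
  have "rsub s \<noteq> {}"
    using subtree_self by (auto simp: right_sub_def)
  then have ne: "{} \<notin> P"
    unfolding P_eq C_def D_def by auto
  show bal: "balanced_partition G (2 ^ k') P"
    using finCD cover ne card_P size card_rsub[OF s_hub]
    by (intro partition_by_counting[where B = "rsub s"]) (auto simp: P_eq C_def)
  have tops_C: "card (tops G A) \<le> 1" if "A \<in> C" for A
  proof -
    obtain a where "tops G A \<subseteq> {a}"
      using \<open>A \<in> C\<close> tops_insert_child_subtree hub_edges(1) tops_subtree
      unfolding C_def left_sub_def right_sub_def by blast
    then show ?thesis
      using card_mono[of "{a}"] by simp
  qed
  have tops_D: "card (tops G A) \<le> 2" if "A \<in> D" for A
  proof -
    obtain x a where "tops G A \<subseteq> {x, a}"
      using \<open>A \<in> D\<close> tops_insert_subtree unfolding D_def right_sub_def by blast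
    then have "card (tops G A) \<le> card {x, a}"
      by (intro card_mono) auto
    also have "\<dots> \<le> 2"
      by (simp add: card_insert_if)
    finally show ?thesis .
  qed
  have part: "partition_on V P" and k: "card P = 2 ^ k'"
    using bal by (auto simp: balanced_iff)
  have double: "(\<Sum>A \<in> P. if A \<in> D then 1 else 0) = (\<Sum>A \<in> D. 1::nat)"
    using finCD sum.inter_restrict[of P "\<lambda>_. 1::nat" D] by (simp add: P_eq Int_absorb1)
  have "cut_value G P + 1 = (\<Sum>A \<in> P. card (tops G A))"
    by (rule cut_value_tops[OF part])
  also have "\<dots> \<le> (\<Sum>A \<in> P. if A \<in> D then 2 else 1)"
    using tops_C tops_D by (intro sum_mono) (simp add: P_eq split: if_split; blast)
  also have "\<dots> = (\<Sum>A \<in> P. 1 + (if A \<in> D then 1 else 0))"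
    by (intro sum.cong) auto
  also have "\<dots> = card P + card D"
    unfolding sum.distrib double card_eq_sum ..
  finally show "cut_value G P + card hubs + 2 \<le> 2 * 2 ^ k'"
    using card_D k card_X card_hubs k_eq by linarith
qed

lemma algorithm_optimal:
  assumes "algorithm_partition G h k' P"
  shows "optimal_partition G (2 ^ k') P"
    and "cut_value G P + card hubs + 2 = 2 * 2 ^ k'"
proof -
  note alg = algorithm_balanced_cut[OF assms]
  show "optimal_partition G (2 ^ k') P"
    unfolding optimal_partition_def
    using alg cut_value_lower_bound by (meson add_le_cancel_right le_trans)
  show "cut_value G P + card hubs + 2 = 2 * 2 ^ k'"
    using alg cut_value_lower_bound by (meson le_antisym)
qed

section \<open>The optimal value\<close>

lemma card_hubs_eq: "(2 * 2 ^ m - 1) * real (card hubs) = 2 ^ k' * 2 ^ m - 2 ^ L"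
proof -
  have "real (2 * 2 ^ m * card R + 2 * 2 ^ m * 2 ^ L) = real (2 ^ k' * 2 ^ m + card R)"
    using card_R_eq by simp
  then show ?thesis
    by (simp add: card_hubs algebra_simps)
qed

text \<open>For \<open>M = 2\<^sup>m \<ge> 4\<close> the number of hubs is at most \<open>k M / (2 M - 1) \<le> 4 k / 7\<close>.\<close>

lemma card_hubs_wide:
  assumes "k' \<le> h - 1"
  shows "7 * real (card hubs) \<le> 4 * 2 ^ k'"
proof -
  have M: "(4::real) \<le> 2 ^ m"
    using power_increasing[of 2 m "2::real"] assms k'_ge by simp
  have "7 * ((2 * 2 ^ m - 1) * real (card hubs)) \<le> 7 * (2 ^ k' * 2 ^ m)"
    unfolding card_hubs_eq by simp
  also have "\<dots> \<le> (2 * 2 ^ m - 1) * (4 * 2 ^ k')"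
  proof -
    have "2 ^ k' * (7 * 2 ^ m) \<le> 2 ^ k' * (8 * 2 ^ m - (4::real))"
      using M by (intro mult_left_mono) auto
    then show ?thesis
      by (simp add: algebra_simps)
  qed
  finally have "(2 * 2 ^ m - 1) * (7 * real (card hubs)) \<le> (2 * 2 ^ m - 1) * (4 * 2 ^ k')"
    by (simp add: mult.left_commute)
  moreover have "0 < 2 * 2 ^ m - (1::real)"
    using M by linarith
  ultimately show ?thesis
    using mult_le_cancel_left_pos by blast
qed

text \<open>Here \<open>t = 2\<close> and the big sets are pairs; the sign comes from the topmost hub level, which is 0 or 1
  according to the parity of \<open>h + 1\<close>.\<close>

lemma card_hubs_pairs:
  assumes "k' = h" shows "3 * real (card hubs) = 2 * 2 ^ k' - 3 / 2 - 1 / 2 * (- 1) ^ k'"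
proof -
  have "t = 2"
    using assms by (simp add: period_def)
  then have "(2::real) ^ L = 2 ^ ((h + 1) mod 2)"
    using L_mod by metis
  also have "\<dots> = 3 / 2 + 1 / 2 * (- 1) ^ k'"
    using assms by (cases "even h") (auto simp: even_iff_mod_2_eq_zero mod_Suc)
  finally have "(2::real) ^ L = 3 / 2 + 1 / 2 * (- 1) ^ k'" .
  then show ?thesis
    using card_hubs_eq assms by simp
qed

text \<open>The bound on \<open>k'\<close> says that \<open>h + 1 < 2 t\<close>, so that there are no bands and the only hub level is
  \<open>L = k' - 1\<close>.\<close>

lemma card_hubs_top:
  assumes "k' \<le> h div 2 + 1" shows "2 * card hubs = 2 ^ k'"
proof -
  have "e + 1 = 1"
    unfolding e_plus_1 using assms k'_ge k'_le
    by (intro div_nat_eqI) (auto simp: period_def)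
  then have "R = {}" "L = k' - 1"
    using band_roots_levels k'_le by (auto simp: period_def)
  then show ?thesis
    using card_hubs k'_ge by (simp flip: power_Suc)
qed

end

theorem lemma18:
  fixes G :: "'a binary_tree" and h k k' :: nat and P :: "'a set set"
  assumes "regular_binary_tree G h" and "h \<ge> 1"
    and "k = 2 ^ k'" and "1 \<le> k'" and "k' \<le> h"
    and "algorithm_partition G h k' P"
  shows "optimal_partition G k P \<and>
    (k' \<le> h - 1 \<longrightarrow> real (cut_value G P) \<ge> 10 / 7 * real k - 2) \<and>
    (k' = h \<longrightarrow> real (cut_value G P) = 4 / 3 * real k - 3 / 2 + 1 / 6 * (- 1) ^ k') \<and>
    (k' \<le> h div 2 + 1 \<longrightarrow> real (cut_value G P) = 3 / 2 * real k - 2)"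
proof -
  interpret balanced_setting G h k'
    using assms by unfold_locales
  have k: "real k = 2 ^ k'"
    using assms(3) by simp
  have "real (cut_value G P + card hubs + 2) = real (2 * 2 ^ k')"
    using algorithm_optimal(2)[OF assms(6)] by simp
  then have cut: "real (cut_value G P) = 2 * real k - real (card hubs) - 2"
    using k by simp
  have top: "2 * real (card hubs) = real k" if "k' \<le> h div 2 + 1"
    using card_hubs_top[OF that] k by (metis of_nat_mult of_nat_numeral of_nat_power)
  show ?thesis
    using algorithm_optimal(1)[OF assms(6)] card_hubs_wide card_hubs_pairs top cut k assms(3)
    by (auto simp: field_simps)
qed

end
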